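(* Let $G$ be a graph on $n\ge 3$ vertices and let $v$ be a cut vertex of $G$. Write $G$ as the vertex sum at $v$ of graphs $G_1,G_2,\ldots,G_k$, $k\ge 2$. Then $$\mathcal{E}(G) = \bigl[\mathcal{E}(G_1)+\mathcal{E}(G_2)+\cdots+\mathcal{E}(G_k)\bigr]_n \cup \bigl[\mathcal{E}(G_1-v)+\mathcal{E}(G_2-v)+\cdots+\mathcal{E}(G_k-v)+\{(1,1)\}\bigr]_n.$$
   Context: All graphs are finite, simple and undirected. $\mathbb{N}$ denotes the nonnegative integers. For a graph $G$ on $n$ vertices and $k\in\{0,\ldots,n\}$, the maximal disconnection $\mathrm{MD}_k(G)$ is the maximum, over all induced subgraphs $F$ of $G$ having $n-k$ vertices, of the number of connected components of $F$ (the graph with no vertices has $0$ components). A pair $(r,s)$ is an elementary inertia of $G$ if for some integer $k$ with $0\le k\le n$ we have $k\le r$, $k\le s$, and $n-\mathrm{MD}_k(G)+k\le r+s\le n$. The set of elementary inertias of $G$ is $\mathcal{E}(G)=\{(r,s)\in\mathbb{N}^2 : (r,s)\text{ is an elementary inertia of }G\}$. For $Q,R\subseteq\mathbb{N}^2$, $Q+R=\{(a+c,b+d):(a,b)\in Q,\ (c,d)\in R\}$, and similarly for three or more sets; $[Q]_n=\{(r,s)\in Q: r+s\le n\}$. If $G_1,\ldots,G_k$ ($k\ge 2$) are graphs, each on at least two vertices, each with a vertex labeled $v$ (and otherwise disjoint), their vertex sum at $v$ is the graph on $\sum_{i=1}^k|G_i|-(k-1)$ vertices obtained by identifying the vertex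 $v$ in all of the $G_i$. $G-v$ denotes the graph obtained from $G$ by deleting the vertex $v$. *)

theory Defs
  imports
    "Graph_Theory.Graph_Theory"
    "HOL-Library.Set_Algebras"
    "HOL-Library.Product_Plus"
begin

text \<open>
  A finite simple undirected graph is a \<open>pair_graph\<close>: a finite vertex set together with a
  symmetric, irreflexive set of ordered pairs of vertices, so an edge \<open>uw\<close> is represented by both
  \<open>(u, w)\<close> and \<open>(w, u)\<close>. Notions that concern a single graph are defined for the more general
  \<open>pre_digraph\<close>; \<open>with_proj\<close> is the coercion between the two types.
\<close>

text \<open>
  \<open>Digraph_Component.connected\<close> demands a nonempty vertex set, hence the graph without vertices
  has no components.
\<close>

definition components :: "('a, 'b) pre_digraph \<Rightarrow> ('a, 'b) pre_digraph set" where
  "components G = {C. pre_digraph.max_subgraph G Digraph_Component.connected C}"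

text \<open>Only meaningful for \<open>k \<le> card (verts G)\<close>; otherwise the maximum is over the empty set.\<close>

definition max_disconnection :: "nat \<Rightarrow> ('a, 'b) pre_digraph \<Rightarrow> nat" where
  "max_disconnection k G =
     Max {card (components F) | F. induced_subgraph F G \<and> card (verts F) + k = card (verts G)}"

definition elementary_inertias :: "('a, 'b) pre_digraph \<Rightarrow> (nat \<times> nat) set" where
  "elementary_inertias G =
     {(r, s). \<exists>k \<le> card (verts G). k \<le> r \<and> k \<le> s \<and>
        int (card (verts G)) - int (max_disconnection k G) + int k \<le> int (r + s) \<and>
        r + s \<le> card (verts G)}"

definition truncate_sum :: "nat \<Rightarrow> (nat \<times> nat) set \<Rightarrow> (nat \<times> nat) set" where
  "truncate_sum n Q = {(r, s) \<in> Q. r + s \<le> n}"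

definition cut_vertex :: "('a, 'b) pre_digraph \<Rightarrow> 'a \<Rightarrow> bool" where
  "cut_vertex G v \<longleftrightarrow>
     v \<in> verts G \<and> card (components G) < card (components (pre_digraph.del_vert G v))"

text \<open>
  The summands \<open>Gs 1, \<dots>, Gs k\<close> all contain the vertex \<open>v\<close> and share no other vertex. They are thus
  already identified at \<open>v\<close>, and their vertex sum is their union.
\<close>

definition is_vertex_sum ::
  "'a pair_pre_digraph \<Rightarrow> 'a \<Rightarrow> nat \<Rightarrow> (nat \<Rightarrow> 'a pair_pre_digraph) \<Rightarrow> bool" where
  "is_vertex_sum G v k Gs \<longleftrightarrow>
     2 \<le> k \<and>
     (\<forall>i \<in> {1..k}. pair_graph (Gs i) \<and> 2 \<le> card (pverts (Gs i)) \<and> v \<in> pverts (Gs i)) \<and>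
     (\<forall>i \<in> {1..k}. \<forall>j \<in> {1..k}. i \<noteq> j \<longrightarrow> pverts (Gs i) \<inter> pverts (Gs j) = {v}) \<and>
     pverts G = (\<Union>i \<in> {1..k}. pverts (Gs i)) \<and>
     parcs G = (\<Union>i \<in> {1..k}. parcs (Gs i))"

end

theory Submission
  imports Defs
begin

text \<open>
  Since a maximum is reached by some vertex set, \<open>(r, s)\<close> is an elementary inertia of a graph on
  \<open>n\<close> vertices iff there is a set \<open>S\<close> of vertices with \<open>|S| \<le> r\<close>, \<open>|S| \<le> s\<close> and
  \<open>n - c(S) + |S| \<le> r + s \<le> n\<close>, where \<open>c(S)\<close> counts the components that are left when \<open>S\<close> is
  deleted (\<open>elementary_inertias_eq_inertia_set\<close>). So a point is certified by a set \<open>S\<close>, and the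
  theorem says how certificates of a vertex sum correspond to families of certificates of the parts.

  For a disjoint union all three quantities \<open>n\<close>, \<open>|S|\<close> and \<open>c\<close> are additive. The Minkowski sum of
  the sets of elementary inertias therefore consists of the points certified by the total
  quantities of a family of deleted sets (\<open>mem_sum_inertia_set\<close>). The nontrivial half is to
  distribute a given point over the parts. Once each part has \<open>|S| \<le> c(S)\<close>, the points certified
  by its set form a nonempty trapezoid, and such trapezoids add up without gaps; a part with
  \<open>|S| > c(S)\<close> is better served by deleting nothing.

  A vertex sum differs from the disjoint union of its \<open>k\<close> parts only at \<open>v\<close>. If the certificate
  contains \<open>v\<close>, then what is left is the disjoint union of what is left of the \<open>G\<^sub>i - v\<close>, and the
  deletion of \<open>v\<close> itself accounts for the summand \<open>(1, 1)\<close>. If it does not contain \<open>v\<close>, then the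
  components of the parts that contain \<open>v\<close> merge into one, so \<open>c\<close> is the total over the parts
  minus \<open>k - 1\<close>, and so is \<open>n\<close>; the difference \<open>n - c\<close> is again additive. Conversely,
  certificates of the parts are united. The only new case is that some, but perhaps not all, of
  them contain \<open>v\<close>. Then \<open>v\<close> has to be deleted from the remaining parts as well, each of which
  loses at most one component thereby, and this loss is made up for by the overlap at \<open>v\<close>
  (\<open>sum_inertia_set_subset\<close>).
\<close>

section \<open>Connected classes of a symmetric relation\<close>

text \<open>
  Components are handled as vertex sets rather than subgraphs: all deleted subgraphs, also those
  of different parts, then live in one type and are compared as sets.
\<close>

definition vcomp :: "'a rel \<Rightarrow> 'a set \<Rightarrow> 'a \<Rightarrow> 'a set" where
  "vcomp R U x = (Restr R U)\<^sup>* `` {x}"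

definition vcomps :: "'a rel \<Rightarrow> 'a set \<Rightarrow> 'a set set" where
  "vcomps R U = vcomp R U ` U"

lemma vcomp_self: "x \<in> vcomp R U x"
  by (simp add: vcomp_def)

lemma vcomp_subset:
  assumes "x \<in> U"
  shows "vcomp R U x \<subseteq> U"
proof
  fix y assume "y \<in> vcomp R U x"
  then have "(x, y) \<in> (Restr R U)\<^sup>*" by (simp add: vcomp_def)
  then show "y \<in> U" by (induction rule: rtrancl_induct) (use assms in auto)
qed

lemma vcomp_eq:
  assumes "sym R" "y \<in> vcomp R U x"
  shows "vcomp R U y = vcomp R U x"
proof -
  have "sym ((Restr R U)\<^sup>*)"
    using assms(1) by (intro sym_rtrancl) (auto simp: sym_def)
  then show ?thesis
    using assms(2) unfolding vcomp_def by (auto dest: symD intro: rtrancl_trans)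
qed

lemma vcomp_mono:
  assumes "R \<subseteq> R'" "U \<subseteq> U'"
  shows "vcomp R U x \<subseteq> vcomp R' U' x"
  unfolding vcomp_def using assms by (intro Image_mono rtrancl_mono) auto

text \<open>
  A path that starts in a set closed under both step relations never leaves it, so it only sees
  the part of the relations inside that set.
\<close>

lemma vcomp_local:
  assumes "x \<in> A"
    and "\<And>y z. y \<in> A \<Longrightarrow> (y, z) \<in> Restr R U \<longleftrightarrow> (y, z) \<in> Restr R' U'"
    and "\<And>y z. y \<in> A \<Longrightarrow> (y, z) \<in> Restr R U \<Longrightarrow> z \<in> A"
  shows "vcomp R U x = vcomp R' U' x"
proof -
  have "(x, y) \<in> (Restr R' U')\<^sup>* \<and> y \<in> A" if "(x, y) \<in> (Restr R U)\<^sup>*" for y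
    using that
  proof (induction rule: rtrancl_induct)
    case (step y z)
    then show ?case using assms(2,3) by (meson rtrancl.rtrancl_into_rtrancl)
  qed (use assms(1) in simp)
  moreover have "(x, y) \<in> (Restr R U)\<^sup>* \<and> y \<in> A" if "(x, y) \<in> (Restr R' U')\<^sup>*" for y
    using that
  proof (induction rule: rtrancl_induct)
    case (step y z)
    then show ?case using assms(2,3) by (meson rtrancl.rtrancl_into_rtrancl)
  qed (use assms(1) in simp)
  ultimately show ?thesis unfolding vcomp_def by blast
qed

lemma vcomps_cong: "Restr R U = Restr R' U \<Longrightarrow> vcomps R U = vcomps R' U"
  by (simp add: vcomps_def vcomp_def)

lemma finite_vcomps: "finite U \<Longrightarrow> finite (vcomps R U)"
  by (simp add: vcomps_def)

lemma card_vcomps_le: "finite U \<Longrightarrow> card (vcomps R U) \<le> card U"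
  by (simp add: vcomps_def card_image_le)

text \<open>
  Exactly one component contains a given vertex of \<open>U\<close>. Setting it aside treats the cases
  \<open>v \<in> U\<close> and \<open>v \<notin> U\<close> uniformly.
\<close>

lemma card_vcomps_avoiding:
  assumes "sym R" "finite U"
  shows "card (vcomps R U) = card {C \<in> vcomps R U. v \<notin> C} + of_bool (v \<in> U)"
proof (cases "v \<in> U")
  case True
  have "{C \<in> vcomps R U. v \<in> C} = {vcomp R U v}"
  proof (intro equalityI subsetI)
    fix C assume "C \<in> {C \<in> vcomps R U. v \<in> C}"
    then show "C \<in> {vcomp R U v}" using vcomp_eq[OF assms(1)] unfolding vcomps_def by blast
  qed (use True vcomp_self[of v R U] in \<open>simp add: vcomps_def\<close>)
  moreover have "card (vcomps R U) = card ({C \<in> vcomps R U. v \<notin> C} \<union> {C \<in> vcomps R U. v \<in> C})"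
    by (rule arg_cong[where f = card]) auto
  moreover have "card ({C \<in> vcomps R U. v \<notin> C} \<union> {C \<in> vcomps R U. v \<in> C})
      = card {C \<in> vcomps R U. v \<notin> C} + card {C \<in> vcomps R U. v \<in> C}"
    using finite_vcomps[OF assms(2)] by (intro card_Un_disjoint) auto
  ultimately show ?thesis using True by simp
next
  case False
  then have "{C \<in> vcomps R U. v \<notin> C} = vcomps R U"
    using vcomp_subset[of _ U R] unfolding vcomps_def by blast
  then show ?thesis using False by simp
qed

text \<open>
  A component that avoids \<open>v\<close> survives the deletion of \<open>v\<close>, so deleting a vertex
  destroys at most one component.
\<close>

lemma card_vcomps_delete:
  assumes "sym R" "finite U"
  shows "card (vcomps R U) \<le> card (vcomps R (U - {v})) + of_bool (v \<in> U)"
proof -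
  have "{C \<in> vcomps R U. v \<notin> C} \<subseteq> vcomps R (U - {v})"
  proof clarify
    fix C assume "C \<in> vcomps R U" "v \<notin> C"
    then obtain x where x: "x \<in> U" "C = vcomp R U x" "v \<notin> vcomp R U x"
      by (auto simp: vcomps_def)
    have "x \<noteq> v" using x vcomp_self[of x R U] by auto
    moreover have "vcomp R U x = vcomp R (U - {v}) x"
    proof (rule vcomp_local[where A = "vcomp R U x"])
      fix y z assume y: "y \<in> vcomp R U x"
      show z: "z \<in> vcomp R U x" if "(y, z) \<in> Restr R U" for z
        using y that unfolding vcomp_def by (auto intro: rtrancl_into_rtrancl)
      show "(y, z) \<in> Restr R U \<longleftrightarrow> (y, z) \<in> Restr R (U - {v})"
        using y z x(3) by auto
    qed (rule vcomp_self)
    ultimately show "C \<in> vcomps R (U - {v})" using x by (auto simp: vcomps_def)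
  qed
  then have "card {C \<in> vcomps R U. v \<notin> C} \<le> card (vcomps R (U - {v}))"
    using assms(2) by (intro card_mono finite_vcomps) auto
  then show ?thesis using card_vcomps_avoiding[OF assms, of v] by simp
qed

section \<open>Elementary inertias in terms of deleted vertex sets\<close>

lemma arc_mono_connected: "arc_mono Digraph_Component.connected"
  unfolding arc_mono_def
  by (metis spanning_def subgraphE wf_digraph.connected_spanning_imp_connected)

lemma strongly_connected_imp_connected:
  assumes "wf_digraph G" "strongly_connected G"
  shows "Digraph_Component.connected G"
  using assms unfolding strongly_connected_def
  by (intro wf_digraph.connectedI) (auto intro: wf_digraph.reachable_mk_symmetricI)

text \<open>
  A maximal connected subgraph is induced, hence symmetric like the whole graph, and for symmetric
  digraphs connectedness and strong connectedness agree.
\<close>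

lemma (in sym_digraph) components_eq_sccs: "components G = sccs"
proof (intro equalityI subsetI)
  fix H assume "H \<in> components G"
  then have H: "max_subgraph Digraph_Component.connected H" by (simp add: components_def)
  then have ind: "induced_subgraph H G"
    using arc_mono_connected by (rule induced_subgraphI_arc_mono)
  have "wf_digraph H" using ind by (rule wf_digraphI_induced)
  moreover have "symmetric H" using sym_arcs ind by (rule induced_graph_imp_symmetric)
  moreover have "Digraph_Component.connected H" using H by (rule max_subgraph_prop)
  ultimately have sc: "strongly_connected H"
    by (rule wf_digraph.symmetric_connected_imp_strongly_connected)
  have "max_subgraph strongly_connected H"
  proof (rule max_subgraphI)
    fix y assume "H \<noteq> y" "subgraph H y" "subgraph y G"
    moreover from \<open>subgraph y G\<close> have "wf_digraph y" by (rule subgraphE)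
    ultimately show "\<not> strongly_connected y"
      using H strongly_connected_imp_connected[of y] unfolding max_subgraph_def by metis
  qed (rule sc, rule induced_imp_subgraph[OF ind])
  then show "H \<in> sccs" by (simp add: sccs_altdef2)
next
  fix H assume H: "H \<in> sccs"
  then have ind: "induced_subgraph H G" and sc: "strongly_connected H" by auto
  have "max_subgraph Digraph_Component.connected H"
  proof (rule max_subgraphI)
    show "Digraph_Component.connected H"
      using sc ind by (intro strongly_connected_imp_connected wf_digraphI_induced)
    show "subgraph H G" using ind by (rule induced_imp_subgraph)
    fix y assume y: "H \<noteq> y" "subgraph H y" "subgraph y G"
    show "\<not> Digraph_Component.connected y"
    proof
      assume con: "Digraph_Component.connected y"
      let ?y = "G \<restriction> verts y"
      have ind_y: "induced_subgraph ?y G" using y(3) by auto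
      have "subgraph y ?y" using y(3) by (rule subgraph_induce_subgraphI2)
      then have "Digraph_Component.connected ?y"
        using con arc_mono_connected unfolding arc_mono_def by (metis induce_subgraph_verts)
      then have sc_y: "strongly_connected ?y"
        using wf_digraphI_induced[OF ind_y] induced_graph_imp_symmetric[OF sym_arcs ind_y]
        by (intro wf_digraph.symmetric_connected_imp_strongly_connected)
      have "subgraph H ?y" using y(2) \<open>subgraph y ?y\<close> by (rule subgraph_trans)
      moreover have "max_subgraph strongly_connected H" using H by (simp add: sccs_altdef2)
      ultimately have "?y = H"
        using sc_y induced_imp_subgraph[OF ind_y] unfolding max_subgraph_def by metis
      then have "subgraph y H" using \<open>subgraph y ?y\<close> by simp
      then show False using y(1,2)
        by (auto simp: subgraph_def compatible_def intro!: pre_digraph.equality)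
    qed
  qed
  then show "H \<in> components G" by (simp add: components_def)
qed

lemma (in sym_digraph) card_components:
  "card (components G) = card (vcomps (arcs_ends G) (verts G))"
proof -
  have restr: "Restr (arcs_ends G) (verts G) = arcs_ends G"
    using adj_in_verts by auto
  have "scc_of u = vcomp (arcs_ends G) (verts G) u" if "u \<in> verts G" for u
    unfolding scc_of_def vcomp_def restr
    using that by (auto simp: reachable_conv' intro: symmetric_reachable')
  then have "scc_of ` verts G = vcomps (arcs_ends G) (verts G)"
    by (simp add: vcomps_def)
  then show ?thesis
    using components_eq_sccs card_sccs_verts sccs_verts_conv_scc_of by simp
qed

lemma (in sym_digraph) card_components_induced:
  assumes "induced_subgraph F G"
  shows "card (components F) = card (vcomps (arcs_ends G) (verts F))"
proof -
  interpret F: sym_digraph F using assms by (rule induced_graph_imp_graph)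
  have "tail F = tail G" "head F = head G"
    using assms unfolding induced_subgraph_def subgraph_def compatible_def by simp_all
  moreover have "arcs F = {e \<in> arcs G. tail G e \<in> verts F \<and> head G e \<in> verts F}"
    using assms by (simp add: induced_subgraph_def)
  ultimately have "Restr (arcs_ends F) (verts F) = Restr (arcs_ends G) (verts F)"
    unfolding arcs_ends_conv by auto
  then have "vcomps (arcs_ends F) (verts F) = vcomps (arcs_ends G) (verts F)" by (rule vcomps_cong)
  then show ?thesis using F.card_components by simp
qed

text \<open>
  The lower bound \<open>n - c + |S|\<close> on \<open>r + s\<close> is written with \<open>c\<close> on the other side, as subtraction of
  natural numbers truncates.
\<close>

definition inertia_set :: "'a rel \<Rightarrow> 'a set \<Rightarrow> (nat \<times> nat) set" where
  "inertia_set R V = {(r, s). \<exists>S \<subseteq> V. card S \<le> r \<and> card S \<le> s \<and>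
     card V + card S \<le> r + s + card (vcomps R (V - S)) \<and> r + s \<le> card V}"

lemma inertia_set_cong:
  assumes "Restr R V = Restr R' V"
  shows "inertia_set R V = inertia_set R' V"
proof -
  have "vcomps R (V - S) = vcomps R' (V - S)" for S
    using assms by (intro vcomps_cong) blast
  then show ?thesis by (simp add: inertia_set_def)
qed

text \<open>
  The maximal disconnection is attained by some set of \<open>k\<close> deleted vertices, which is the
  certificate. Conversely, replacing the number of components left by a set \<open>S\<close> by the maximal
  disconnection for \<open>|S|\<close> only weakens the lower bound on \<open>r + s\<close>.
\<close>

lemma elementary_inertias_eq_inertia_set:
  assumes "fin_digraph G" "sym_digraph G"
  shows "elementary_inertias G = inertia_set (arcs_ends G) (verts G)"
proof -
  interpret fin_digraph G by fact
  interpret sym_digraph G by fact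
  let ?c = "\<lambda>S. card (vcomps (arcs_ends G) (verts G - S))"
  let ?M = "\<lambda>k. {card (components F) | F. induced_subgraph F G \<and> card (verts F) + k = card (verts G)}"
  have M_eq: "?M k = ?c ` {S. S \<subseteq> verts G \<and> card S = k}" (is "_ = ?N") for k
  proof (intro equalityI subsetI)
    fix x assume "x \<in> ?M k"
    then obtain F where F: "x = card (components F)" "induced_subgraph F G"
      "card (verts F) + k = card (verts G)" by blast
    have sub: "verts F \<subseteq> verts G" using F(2) by blast
    have "card (verts G - verts F) = k"
      using F(3) sub finite_verts by (simp add: card_Diff_subset finite_subset)
    moreover have "x = ?c (verts G - verts F)"
      using F(1,2) sub by (simp add: card_components_induced double_diff)
    ultimately show "x \<in> ?N" by blast
  next
    fix x assume "x \<in> ?N"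
    then obtain S where S: "S \<subseteq> verts G" "card S = k" "x = ?c S" by blast
    let ?F = "G \<restriction> (verts G - S)"
    have ind: "induced_subgraph ?F G" by auto
    have "card (verts ?F) + k = card (verts G)"
      using S card_mono[OF finite_verts S(1)]
      by (simp add: card_Diff_subset finite_subset[OF S(1) finite_verts])
    moreover have "x = card (components ?F)"
      using S ind by (simp add: card_components_induced)
    ultimately show "x \<in> ?M k" using ind by blast
  qed
  have fin: "finite {S. S \<subseteq> verts G \<and> card S = k}" for k by simp
  have attained: "\<exists>S \<subseteq> verts G. card S = k \<and> max_disconnection k G = ?c S"
    if "k \<le> card (verts G)" for k
  proof -
    have "{S. S \<subseteq> verts G \<and> card S = k} \<noteq> {}"
      using obtain_subset_with_card_n[OF that] by blast
    then have "max_disconnection k G \<in> ?c ` {S. S \<subseteq> verts G \<and> card S = k}"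
      unfolding max_disconnection_def M_eq using fin by (intro Max_in) auto
    then show ?thesis by blast
  qed
  have upper: "?c S \<le> max_disconnection (card S) G" if "S \<subseteq> verts G" for S
    unfolding max_disconnection_def M_eq using fin that by (intro Max_ge) auto
  show ?thesis
  proof (intro equalityI subsetI; clarify)
    fix r s assume "(r, s) \<in> elementary_inertias G"
    then obtain k where k: "k \<le> card (verts G)" "k \<le> r" "k \<le> s"
        "int (card (verts G)) - int (max_disconnection k G) + int k \<le> int (r + s)"
        "r + s \<le> card (verts G)"
      by (auto simp: elementary_inertias_def)
    obtain S where "S \<subseteq> verts G" "card S = k" "max_disconnection k G = ?c S"
      using attained[OF k(1)] by blast
    with k show "(r, s) \<in> inertia_set (arcs_ends G) (verts G)"
      unfolding inertia_set_def by (auto intro!: exI[of _ S])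
  next
    fix r s assume "(r, s) \<in> inertia_set (arcs_ends G) (verts G)"
    then obtain S where S: "S \<subseteq> verts G" "card S \<le> r" "card S \<le> s"
        "card (verts G) + card S \<le> r + s + ?c S" "r + s \<le> card (verts G)"
      by (auto simp: inertia_set_def)
    have "card S \<le> card (verts G)" using S(1) by (simp add: card_mono)
    with S upper[OF S(1)] show "(r, s) \<in> elementary_inertias G"
      unfolding elementary_inertias_def by (auto intro!: exI[of _ "card S"])
  qed
qed

section \<open>Minkowski sums of elementary inertias\<close>

definition trapezoid :: "nat \<Rightarrow> nat \<Rightarrow> nat \<Rightarrow> (nat \<times> nat) set" where
  "trapezoid k l h = {(r, s). k \<le> r \<and> k \<le> s \<and> l \<le> r + s \<and> r + s \<le> h}"

text \<open>
  The trapezoids are the integer points of plane polygons whose edges have common directions, so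
  their Minkowski sum is determined by the sums of the bounds. The hypotheses \<open>2 * k \<le> l \<le> h\<close>
  ensure that every diagonal \<open>r + s = t\<close> with \<open>l \<le> t \<le> h\<close> really meets the trapezoid.
\<close>

lemma trapezoid_add_superset:
  assumes "2 * k \<le> l" "l \<le> h" "2 * k' \<le> l'" "l' \<le> h'"
  shows "trapezoid (k + k') (l + l') (h + h') \<subseteq> trapezoid k l h + trapezoid k' l' h'"
proof clarify
  fix r s assume "(r, s) \<in> trapezoid (k + k') (l + l') (h + h')"
  then have rs: "k + k' \<le> r" "k + k' \<le> s" "l + l' \<le> r + s" "r + s \<le> h + h'"
    by (auto simp: trapezoid_def)
  \<comment> \<open>The diagonal of the first summand is the lowest one that leaves at most \<open>h'\<close> for the second;
    its first coordinate is then the least one that leaves at least \<open>k'\<close> for the second coordinate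
    of the other summand.\<close>
  define t where "t = max l (r + s - h')"
  have t: "l \<le> t" "t \<le> h" "t + l' \<le> r + s" "r + s \<le> t + h'"
    using assms rs unfolding t_def by linarith+
  define a where "a = max k (r + k' + t - (r + s))"
  have a: "k \<le> a" "a + k' \<le> r" "a + k \<le> t" "r + k' + t \<le> r + s + a"
    using assms rs t unfolding a_def by linarith+
  have "(a, t - a) \<in> trapezoid k l h"
    using a t by (auto simp: trapezoid_def)
  moreover have "(r - a, s - (t - a)) \<in> trapezoid k' l' h'"
    using a t unfolding trapezoid_def by auto
  ultimately have "(a, t - a) + (r - a, s - (t - a)) \<in> trapezoid k l h + trapezoid k' l' h'"
    by (rule set_plus_intro)
  moreover have "(a, t - a) + (r - a, s - (t - a)) = (r, s)"
    using a by auto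
  ultimately show "(r, s) \<in> trapezoid k l h + trapezoid k' l' h'" by simp
qed

lemma trapezoid_sum_superset:
  assumes "finite I" "\<And>i. i \<in> I \<Longrightarrow> 2 * k i \<le> l i" "\<And>i. i \<in> I \<Longrightarrow> l i \<le> h i"
  shows "trapezoid (\<Sum>i\<in>I. k i) (\<Sum>i\<in>I. l i) (\<Sum>i\<in>I. h i) \<subseteq> (\<Sum>i\<in>I. trapezoid (k i) (l i) (h i))"
  using assms
proof (induction I rule: finite_induct)
  case empty
  then show ?case by (auto simp: trapezoid_def zero_prod_def)
next
  case (insert x F)
  have "2 * (\<Sum>i\<in>F. k i) \<le> (\<Sum>i\<in>F. l i)"
    using insert.prems(1) by (simp add: sum_distrib_left sum_mono)
  moreover have "(\<Sum>i\<in>F. l i) \<le> (\<Sum>i\<in>F. h i)"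
    using insert.prems(2) by (simp add: sum_mono)
  ultimately have "trapezoid (k x + (\<Sum>i\<in>F. k i)) (l x + (\<Sum>i\<in>F. l i)) (h x + (\<Sum>i\<in>F. h i))
      \<subseteq> trapezoid (k x) (l x) (h x) + trapezoid (\<Sum>i\<in>F. k i) (\<Sum>i\<in>F. l i) (\<Sum>i\<in>F. h i)"
    using insert.prems by (intro trapezoid_add_superset) auto
  also have "\<dots> \<subseteq> trapezoid (k x) (l x) (h x) + (\<Sum>i\<in>F. trapezoid (k i) (l i) (h i))"
    using insert.IH insert.prems by (intro set_plus_mono2) auto
  finally show ?case using insert.hyps by simp
qed

text \<open>
  Deleting more vertices than there are components left is worse than deleting nothing, both for
  the number of deleted vertices and for its excess over the number of components.
\<close>

lemma efficient_deletion:
  fixes R :: "'a rel"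
  assumes "S \<subseteq> V"
  obtains S' where "S' \<subseteq> V" "card S' \<le> card (vcomps R (V - S'))" "card S' \<le> card S"
    "card S' + card (vcomps R (V - S)) \<le> card S + card (vcomps R (V - S'))"
proof (cases "card S \<le> card (vcomps R (V - S))")
  case True
  then show ?thesis using that[of S] assms by simp
next
  case False
  then show ?thesis using that[of "{}"] by simp
qed

text \<open>
  The right-hand side says that \<open>(r, s)\<close> is an elementary inertia of the disjoint union. From left
  to right the inequalities of the parts are added up. From right to left the family of deleted
  sets is first made efficient, which turns the points certified in each part into a trapezoid
  whose bounds satisfy the hypotheses of \<open>trapezoid_sum_superset\<close>.
\<close>

lemma mem_sum_inertia_set:
  assumes "finite I" "\<And>i. i \<in> I \<Longrightarrow> finite (V i)"
  shows "(r, s) \<in> (\<Sum>i\<in>I. inertia_set (R i) (V i)) \<longleftrightarrow>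
    (\<exists>S. (\<forall>i\<in>I. S i \<subseteq> V i) \<and> (\<Sum>i\<in>I. card (S i)) \<le> r \<and> (\<Sum>i\<in>I. card (S i)) \<le> s \<and>
      (\<Sum>i\<in>I. card (V i)) + (\<Sum>i\<in>I. card (S i)) \<le> r + s + (\<Sum>i\<in>I. card (vcomps (R i) (V i - S i))) \<and>
      r + s \<le> (\<Sum>i\<in>I. card (V i)))" (is "?L \<longleftrightarrow> ?P")
proof
  assume ?L
  then obtain f where f: "(r, s) = sum f I" "\<forall>i\<in>I. f i \<in> inertia_set (R i) (V i)"
    using set_sum_alt[OF assms(1), of "\<lambda>i. inertia_set (R i) (V i)"] by auto
  have "\<forall>i\<in>I. \<exists>S. S \<subseteq> V i \<and> card S \<le> fst (f i) \<and> card S \<le> snd (f i) \<and>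
      card (V i) + card S \<le> fst (f i) + snd (f i) + card (vcomps (R i) (V i - S)) \<and>
      fst (f i) + snd (f i) \<le> card (V i)"
  proof
    fix i assume "i \<in> I"
    then have "(fst (f i), snd (f i)) \<in> inertia_set (R i) (V i)" using f(2) by simp
    then show "\<exists>S. S \<subseteq> V i \<and> card S \<le> fst (f i) \<and> card S \<le> snd (f i) \<and>
        card (V i) + card S \<le> fst (f i) + snd (f i) + card (vcomps (R i) (V i - S)) \<and>
        fst (f i) + snd (f i) \<le> card (V i)"
      unfolding inertia_set_def by blast
  qed
  then obtain S where S: "\<forall>i\<in>I. S i \<subseteq> V i \<and> card (S i) \<le> fst (f i) \<and> card (S i) \<le> snd (f i) \<and>
      card (V i) + card (S i) \<le> fst (f i) + snd (f i) + card (vcomps (R i) (V i - S i)) \<and>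
      fst (f i) + snd (f i) \<le> card (V i)"
    by (rule bchoice[THEN exE])
  have rs: "r = (\<Sum>i\<in>I. fst (f i))" "s = (\<Sum>i\<in>I. snd (f i))"
    using f(1) by (metis fst_conv fst_sum, metis snd_conv snd_sum)
  show ?P
    unfolding rs sum.distrib[symmetric] using S by (intro exI[of _ S] conjI sum_mono) auto
next
  assume ?P
  then obtain S where S: "\<forall>i\<in>I. S i \<subseteq> V i"
      and rs: "(\<Sum>i\<in>I. card (S i)) \<le> r" "(\<Sum>i\<in>I. card (S i)) \<le> s"
        "(\<Sum>i\<in>I. card (V i)) + (\<Sum>i\<in>I. card (S i)) \<le> r + s + (\<Sum>i\<in>I. card (vcomps (R i) (V i - S i)))"
        "r + s \<le> (\<Sum>i\<in>I. card (V i))"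
    by blast
  have "\<forall>i\<in>I. \<exists>T. T \<subseteq> V i \<and> card T \<le> card (vcomps (R i) (V i - T)) \<and> card T \<le> card (S i) \<and>
      card T + card (vcomps (R i) (V i - S i)) \<le> card (S i) + card (vcomps (R i) (V i - T))"
    using S by (metis efficient_deletion)
  then obtain T where T: "\<forall>i\<in>I. T i \<subseteq> V i \<and> card (T i) \<le> card (vcomps (R i) (V i - T i)) \<and>
      card (T i) \<le> card (S i) \<and>
      card (T i) + card (vcomps (R i) (V i - S i)) \<le> card (S i) + card (vcomps (R i) (V i - T i))"
    by (rule bchoice[THEN exE])
  let ?c = "\<lambda>i. card (vcomps (R i) (V i - T i))"
  let ?l = "\<lambda>i. card (V i) + card (T i) - ?c i"
  have c_le: "?c i + card (T i) \<le> card (V i)" if "i \<in> I" for i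
  proof -
    have "card (V i - T i) + card (T i) = card (V i)"
      using T assms(2) that by (metis card_Diff_subset card_mono finite_subset le_add_diff_inverse2)
    then show ?thesis
      using card_vcomps_le[of "V i - T i" "R i"] assms(2)[OF that] by simp
  qed
  have "(\<Sum>i\<in>I. card (T i)) + (\<Sum>i\<in>I. card (vcomps (R i) (V i - S i)))
      \<le> (\<Sum>i\<in>I. card (S i)) + (\<Sum>i\<in>I. ?c i)"
    unfolding sum.distrib[symmetric] using T by (intro sum_mono) auto
  moreover have "(\<Sum>i\<in>I. ?l i) + (\<Sum>i\<in>I. ?c i) = (\<Sum>i\<in>I. card (V i)) + (\<Sum>i\<in>I. card (T i))"
    unfolding sum.distrib[symmetric]
  proof (intro sum.cong refl)
    fix i assume "i \<in> I"
    then show "?l i + ?c i = card (V i) + card (T i)" using c_le[of i] by linarith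
  qed
  moreover have "(\<Sum>i\<in>I. card (T i)) \<le> (\<Sum>i\<in>I. card (S i))"
    using T by (intro sum_mono) auto
  ultimately have "(r, s) \<in> trapezoid (\<Sum>i\<in>I. card (T i)) (\<Sum>i\<in>I. ?l i) (\<Sum>i\<in>I. card (V i))"
    using rs unfolding trapezoid_def by auto
  also have "\<dots> \<subseteq> (\<Sum>i\<in>I. trapezoid (card (T i)) (?l i) (card (V i)))"
  proof (intro trapezoid_sum_superset assms(1))
    fix i assume i: "i \<in> I"
    show "2 * card (T i) \<le> ?l i" using c_le[OF i] by linarith
    show "?l i \<le> card (V i)" using T i by auto
  qed
  also have "\<dots> \<subseteq> (\<Sum>i\<in>I. inertia_set (R i) (V i))"
  proof -
    have "trapezoid (card (T i)) (?l i) (card (V i)) \<subseteq> inertia_set (R i) (V i)" if "i \<in> I" for i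
      using bspec[OF T that] unfolding trapezoid_def inertia_set_def
      by (auto intro!: exI[of _ "T i"])
    then show ?thesis unfolding set_sum_alt[OF assms(1)] by blast
  qed
  finally show ?L .
qed

section \<open>Component counts in a vertex sum\<close>

locale vertex_sum =
  fixes I :: "'i set" and R :: "'i \<Rightarrow> 'a rel" and V :: "'i \<Rightarrow> 'a set" and v :: 'a
  assumes finite_index: "finite I" and index_nonempty: "I \<noteq> {}"
    and finite_part: "i \<in> I \<Longrightarrow> finite (V i)"
    and centre_in_part: "i \<in> I \<Longrightarrow> v \<in> V i"
    and sym_part: "i \<in> I \<Longrightarrow> sym (R i)"
    and part_closed: "i \<in> I \<Longrightarrow> R i \<subseteq> V i \<times> V i"
    and parts_meet: "i \<in> I \<Longrightarrow> j \<in> I \<Longrightarrow> i \<noteq> j \<Longrightarrow> V i \<inter> V j = {v}"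
begin

definition total_verts :: "'a set" where "total_verts = (\<Union>i\<in>I. V i)"

definition total_rel :: "'a rel" where "total_rel = (\<Union>i\<in>I. R i)"

lemma finite_total_verts: "finite total_verts"
  unfolding total_verts_def using finite_index finite_part by auto

lemma sym_total_rel: "sym total_rel"
  unfolding total_rel_def using sym_part by (auto simp: sym_def)

lemma centre_in_total: "v \<in> total_verts"
  unfolding total_verts_def using index_nonempty centre_in_part by auto

lemma part_unique:
  "i \<in> I \<Longrightarrow> j \<in> I \<Longrightarrow> x \<in> V i \<Longrightarrow> x \<in> V j \<Longrightarrow> x \<noteq> v \<Longrightarrow> i = j"
  using parts_meet by blast

lemma card_minus_centre:
  assumes "U \<subseteq> total_verts"
  shows "card (U - {v}) = (\<Sum>i\<in>I. card (U \<inter> V i - {v}))"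
proof -
  have "U - {v} = (\<Union>i\<in>I. U \<inter> V i - {v})"
    using assms by (auto simp: total_verts_def)
  moreover have "card (\<Union>i\<in>I. U \<inter> V i - {v}) = (\<Sum>i\<in>I. card (U \<inter> V i - {v}))"
  proof (rule card_UN_disjoint)
    show "\<forall>i\<in>I. \<forall>j\<in>I. i \<noteq> j \<longrightarrow> (U \<inter> V i - {v}) \<inter> (U \<inter> V j - {v}) = {}"
      using part_unique by blast
  qed (use finite_index finite_part in auto)
  ultimately show ?thesis by simp
qed

text \<open>
  An edge that leaves a vertex other than \<open>v\<close> stays within the part of that vertex. A component
  that avoids \<open>v\<close> can thus not tell the vertex sum from that part, and parts share no component of
  this kind. This holds whether or not \<open>v\<close> itself belongs to \<open>U\<close>.
\<close>

lemma avoiding_components: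
  assumes "U \<subseteq> total_verts"
  shows "{C \<in> vcomps total_rel U. v \<notin> C} = (\<Union>i\<in>I. {C \<in> vcomps (R i) (U \<inter> V i). v \<notin> C})"
proof -
  have local: "vcomp (R i) (U \<inter> V i) x = vcomp total_rel U x"
    if i: "i \<in> I" and x: "x \<in> U \<inter> V i" and v: "v \<notin> vcomp (R i) (U \<inter> V i) x" for i x
  proof (rule vcomp_local[where A = "vcomp (R i) (U \<inter> V i) x"])
    fix y z assume y: "y \<in> vcomp (R i) (U \<inter> V i) x"
    have yV: "y \<in> U \<inter> V i" "y \<noteq> v" using y v vcomp_subset[OF x] by auto
    show "z \<in> vcomp (R i) (U \<inter> V i) x" if "(y, z) \<in> Restr (R i) (U \<inter> V i)"
      using y that unfolding vcomp_def by (auto intro: rtrancl_into_rtrancl)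
    show "(y, z) \<in> Restr (R i) (U \<inter> V i) \<longleftrightarrow> (y, z) \<in> Restr total_rel U"
    proof
      assume "(y, z) \<in> Restr total_rel U"
      then obtain j where j: "j \<in> I" "(y, z) \<in> R j" "z \<in> U" by (auto simp: total_rel_def)
      have "y \<in> V j" "z \<in> V j" using part_closed[OF j(1)] j(2) by auto
      moreover from this have "j = i" using part_unique[of j i y] i j yV by auto
      ultimately show "(y, z) \<in> Restr (R i) (U \<inter> V i)" using j yV by auto
    qed (use i in \<open>auto simp: total_rel_def\<close>)
  qed (rule vcomp_self)
  show ?thesis
  proof (intro equalityI subsetI)
    fix C assume "C \<in> {C \<in> vcomps total_rel U. v \<notin> C}"
    then obtain x where x: "x \<in> U" "C = vcomp total_rel U x" "v \<notin> C"
      by (auto simp: vcomps_def)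
    obtain i where i: "i \<in> I" "x \<in> V i" using x assms by (auto simp: total_verts_def)
    have "vcomp (R i) (U \<inter> V i) x \<subseteq> C"
      unfolding x(2) using i by (intro vcomp_mono) (auto simp: total_rel_def)
    then have "C = vcomp (R i) (U \<inter> V i) x" using x i local[of i x] by auto
    then show "C \<in> (\<Union>i\<in>I. {C \<in> vcomps (R i) (U \<inter> V i). v \<notin> C})"
      using x i unfolding vcomps_def by blast
  next
    fix C assume "C \<in> (\<Union>i\<in>I. {C \<in> vcomps (R i) (U \<inter> V i). v \<notin> C})"
    then obtain i x where "i \<in> I" "x \<in> U \<inter> V i" "C = vcomp (R i) (U \<inter> V i) x" "v \<notin> C"
      by (auto simp: vcomps_def)
    then show "C \<in> {C \<in> vcomps total_rel U. v \<notin> C}"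
      using local[of i x] unfolding vcomps_def by auto
  qed
qed

lemma card_avoiding_components:
  assumes "U \<subseteq> total_verts"
  shows "card {C \<in> vcomps total_rel U. v \<notin> C} = (\<Sum>i\<in>I. card {C \<in> vcomps (R i) (U \<inter> V i). v \<notin> C})"
  unfolding avoiding_components[OF assms]
proof (rule card_UN_disjoint)
  show "\<forall>i\<in>I. finite {C \<in> vcomps (R i) (U \<inter> V i). v \<notin> C}"
    using finite_part by (simp add: finite_vcomps)
  have "C \<noteq> {} \<and> C \<subseteq> V i" if "C \<in> vcomps (R i) (U \<inter> V i)" for C i
    using that vcomp_self[of _ "R i" "U \<inter> V i"] vcomp_subset[of _ "U \<inter> V i" "R i"]
    unfolding vcomps_def by blast
  then show "\<forall>i\<in>I. \<forall>j\<in>I. i \<noteq> j \<longrightarrow>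
      {C \<in> vcomps (R i) (U \<inter> V i). v \<notin> C} \<inter> {C \<in> vcomps (R j) (U \<inter> V j). v \<notin> C} = {}"
    using part_unique by blast
qed (rule finite_index)

lemma card_vcomps_without_centre:
  assumes "U \<subseteq> total_verts" "v \<notin> U"
  shows "card (vcomps total_rel U) = (\<Sum>i\<in>I. card (vcomps (R i) (U \<inter> V i)))"
proof -
  have "finite U" using assms(1) finite_total_verts by (rule finite_subset)
  moreover have "card (vcomps (R i) (U \<inter> V i)) = card {C \<in> vcomps (R i) (U \<inter> V i). v \<notin> C}"
    if "i \<in> I" for i
    using card_vcomps_avoiding[of "R i" "U \<inter> V i" v] that assms finite_part sym_part by simp
  ultimately show ?thesis
    using card_vcomps_avoiding[OF sym_total_rel, of U v] card_avoiding_components[OF assms(1)] assms(2)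
    by simp
qed

text \<open>
  The components that contain \<open>v\<close>, one in each part, merge into a single one.
\<close>

lemma card_vcomps_with_centre:
  assumes "U \<subseteq> total_verts" "v \<in> U"
  shows "card (vcomps total_rel U) + card I = (\<Sum>i\<in>I. card (vcomps (R i) (U \<inter> V i))) + 1"
proof -
  have "finite U" using assms(1) finite_total_verts by (rule finite_subset)
  moreover have "card (vcomps (R i) (U \<inter> V i)) = card {C \<in> vcomps (R i) (U \<inter> V i). v \<notin> C} + 1"
    if "i \<in> I" for i
    using card_vcomps_avoiding[of "R i" "U \<inter> V i" v] that assms finite_part sym_part centre_in_part
    by simp
  ultimately show ?thesis
    using card_vcomps_avoiding[OF sym_total_rel, of U v] card_avoiding_components[OF assms(1)] assms(2)
    by (simp add: sum_Suc)
qed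

lemma card_total_minus_centre: "card total_verts = (\<Sum>i\<in>I. card (V i - {v})) + 1"
proof -
  have "total_verts \<inter> V i = V i" if "i \<in> I" for i
    using that by (auto simp: total_verts_def)
  then have "card (total_verts - {v}) = (\<Sum>i\<in>I. card (V i - {v}))"
    using card_minus_centre[of total_verts] by simp
  then show ?thesis
    using card.remove[OF finite_total_verts centre_in_total] by simp
qed

lemma card_total: "card total_verts + card I = (\<Sum>i\<in>I. card (V i)) + 1"
proof -
  have "(\<Sum>i\<in>I. card (V i)) = (\<Sum>i\<in>I. card (V i - {v}) + 1)"
    using card.remove[OF finite_part centre_in_part] by (intro sum.cong) auto
  then show ?thesis using card_total_minus_centre by (simp add: sum_Suc)
qed

section \<open>Elementary inertias of a vertex sum\<close>

lemma card_index_pos: "card I \<ge> 1"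
  using finite_index index_nonempty by (simp add: Suc_leI card_gt_0_iff)

text \<open>
  The \<open>-1\<close> in both coordinates pays for \<open>v\<close>: the sum \<open>r + s\<close> drops by two, which makes up for one
  vertex less in the graph and one less in the deleted set.
\<close>

lemma inertia_set_delete_centre:
  assumes "S \<subseteq> total_verts" "v \<in> S" "card S \<le> r" "card S \<le> s" "r + s \<le> card total_verts"
    "card total_verts + card S \<le> r + s + card (vcomps total_rel (total_verts - S))"
  shows "(r, s) \<in> (\<Sum>i\<in>I. inertia_set (R i) (V i - {v})) + {(1, 1)}"
proof -
  let ?S = "\<lambda>i. S \<inter> V i - {v}"
  have parts: "(total_verts - S) \<inter> V i = V i - {v} - ?S i" if "i \<in> I" for i
    using that assms(2) by (auto simp: total_verts_def)
  have "card (vcomps total_rel (total_verts - S)) = (\<Sum>i\<in>I. card (vcomps (R i) (V i - {v} - ?S i)))"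
    using card_vcomps_without_centre[of "total_verts - S"] assms(2) parts by simp
  moreover have card_S: "card S = (\<Sum>i\<in>I. card (?S i)) + 1"
    using card_minus_centre[OF assms(1)] assms(1,2) finite_total_verts
    by (metis Suc_eq_plus1 card.remove finite_subset)
  moreover note card_total_minus_centre
  ultimately have "(r - 1, s - 1) \<in> (\<Sum>i\<in>I. inertia_set (R i) (V i - {v}))"
    using assms(3-) finite_index finite_part
    by (subst mem_sum_inertia_set) (auto intro!: exI[of _ ?S])
  then have "(r - 1, s - 1) + (1, 1) \<in> (\<Sum>i\<in>I. inertia_set (R i) (V i - {v})) + {(1, 1)}"
    by (intro set_plus_intro) auto
  moreover have "(r - 1, s - 1) + (1, 1) = (r, s)" using card_S assms(3,4) by simp
  ultimately show ?thesis by simp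
qed

text \<open>
  Passing from the whole to the parts raises the number of vertices and the number of components
  by the same amount \<open>card I - 1\<close>, so the inequality between them is inherited.
\<close>

lemma inertia_set_keep_centre:
  assumes "S \<subseteq> total_verts" "v \<notin> S" "card S \<le> r" "card S \<le> s" "r + s \<le> card total_verts"
    "card total_verts + card S \<le> r + s + card (vcomps total_rel (total_verts - S))"
  shows "(r, s) \<in> (\<Sum>i\<in>I. inertia_set (R i) (V i))"
proof -
  let ?S = "\<lambda>i. S \<inter> V i"
  have parts: "(total_verts - S) \<inter> V i = V i - ?S i" if "i \<in> I" for i
    using that by (auto simp: total_verts_def)
  have "card (vcomps total_rel (total_verts - S)) + card I
      = (\<Sum>i\<in>I. card (vcomps (R i) (V i - ?S i))) + 1"
    using card_vcomps_with_centre[of "total_verts - S"] assms(2) centre_in_total parts by simp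
  moreover have "card S = (\<Sum>i\<in>I. card (?S i))"
    using card_minus_centre[OF assms(1)] assms(2) by simp
  moreover note card_total card_index_pos
  ultimately show ?thesis
    using assms(3-) finite_index finite_part
    by (subst mem_sum_inertia_set) (auto intro!: exI[of _ ?S])
qed

text \<open>
  Suppose that \<open>m \<ge> 1\<close> of the \<open>k\<close> deleted sets contain \<open>v\<close>. In the union of all of them \<open>v\<close> counts once
  instead of \<open>m\<close> times, and the vertex sum has \<open>k - 1\<close> vertices less than its parts together; this
  gains \<open>(m - 1) + (k - 1)\<close>. Deleting \<open>v\<close> from the other \<open>k - m\<close> parts costs at most one component
  in each. The balance \<open>2 * (m - 1)\<close> is nonnegative.
\<close>

lemma sum_inertia_set_subset:
  assumes "(r, s) \<in> (\<Sum>i\<in>I. inertia_set (R i) (V i))" "r + s \<le> card total_verts"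
  shows "(r, s) \<in> inertia_set total_rel total_verts"
proof -
  obtain S where S: "\<forall>i\<in>I. S i \<subseteq> V i" "(\<Sum>i\<in>I. card (S i)) \<le> r" "(\<Sum>i\<in>I. card (S i)) \<le> s"
      "(\<Sum>i\<in>I. card (V i)) + (\<Sum>i\<in>I. card (S i)) \<le> r + s + (\<Sum>i\<in>I. card (vcomps (R i) (V i - S i)))"
    using assms(1) finite_index finite_part by (subst (asm) mem_sum_inertia_set) auto
  define T where "T = (\<Union>i\<in>I. S i)"
  have T: "T \<subseteq> total_verts" using S(1) by (auto simp: T_def total_verts_def)
  have T_part: "T \<inter> V i - {v} = S i - {v}" if "i \<in> I" for i
    using that S(1) part_unique unfolding T_def by blast
  have fin_S: "finite (S i)" if "i \<in> I" for i
    using that S(1) finite_part finite_subset by blast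
  \<comment> \<open>The number of deleted sets that contain \<open>v\<close>.\<close>
  let ?m = "\<Sum>i\<in>I. of_bool (v \<in> S i) :: nat"
  have card_T_minus: "card (T - {v}) = (\<Sum>i\<in>I. card (S i - {v}))"
    using card_minus_centre[OF T] T_part by simp
  have "card (S i) = card (S i - {v}) + of_bool (v \<in> S i)" if "i \<in> I" for i
    using card.remove[OF fin_S[OF that], of v] by (cases "v \<in> S i") simp_all
  then have card_S: "(\<Sum>i\<in>I. card (S i)) = card (T - {v}) + ?m"
    using card_T_minus by (simp add: sum.distrib)
  have goal: "card T \<le> (\<Sum>i\<in>I. card (S i)) \<and>
      card total_verts + card T \<le> r + s + card (vcomps total_rel (total_verts - T))"
  proof (cases "v \<in> T")
    case True
    then obtain i0 where "i0 \<in> I" "v \<in> S i0" by (auto simp: T_def)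
    then have m: "?m \<ge> 1"
      using member_le_sum[of i0 I "\<lambda>i. of_bool (v \<in> S i) :: nat"] finite_index by simp
    have card_T: "card T = card (T - {v}) + 1"
      using True T finite_total_verts by (metis Suc_eq_plus1 card.remove finite_subset)
    have "card (vcomps (R i) (V i - S i)) + of_bool (v \<in> S i)
        \<le> card (vcomps (R i) ((total_verts - T) \<inter> V i)) + 1" if i: "i \<in> I" for i
    proof -
      have "(total_verts - T) \<inter> V i = V i - S i - {v}"
        using T_part[OF i] True i centre_in_part by (auto simp: total_verts_def)
      then show ?thesis
        using card_vcomps_delete[of "R i" "V i - S i" v] sym_part finite_part centre_in_part i
        by auto
    qed
    then have "(\<Sum>i\<in>I. card (vcomps (R i) (V i - S i)) + of_bool (v \<in> S i))
        \<le> (\<Sum>i\<in>I. card (vcomps (R i) ((total_verts - T) \<inter> V i)) + 1)"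
      by (rule sum_mono)
    also have "\<dots> = card (vcomps total_rel (total_verts - T)) + card I"
      using card_vcomps_without_centre[of "total_verts - T"] True by (simp add: sum_Suc)
    finally show ?thesis
      using S(4) card_S card_T card_total m by (simp add: sum.distrib)
  next
    case False
    have "(total_verts - T) \<inter> V i = V i - S i" if i: "i \<in> I" for i
      using T_part[OF i] False i by (auto simp: total_verts_def T_def)
    then have "card (vcomps total_rel (total_verts - T)) + card I
        = (\<Sum>i\<in>I. card (vcomps (R i) (V i - S i))) + 1"
      using card_vcomps_with_centre[of "total_verts - T"] False centre_in_total by simp
    moreover have "card T = (\<Sum>i\<in>I. card (S i))"
    proof -
      have "?m = 0" using False by (auto simp: T_def)
      then show ?thesis using False card_S by simp
    qed
    ultimately show ?thesis using S(4) card_total by simp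
  qed
  then show ?thesis
    unfolding inertia_set_def using T S(2,3) assms(2) by (auto intro!: exI[of _ T])
qed

lemma sum_inertia_set_deleted_subset:
  assumes "(r, s) \<in> (\<Sum>i\<in>I. inertia_set (R i) (V i - {v})) + {(1, 1)}" "r + s \<le> card total_verts"
  shows "(r, s) \<in> inertia_set total_rel total_verts"
proof -
  obtain a b where rs: "r = a + 1" "s = b + 1"
    and ab: "(a, b) \<in> (\<Sum>i\<in>I. inertia_set (R i) (V i - {v}))"
    using assms(1) by (auto simp: set_plus_def)
  obtain S where S: "\<forall>i\<in>I. S i \<subseteq> V i - {v}" "(\<Sum>i\<in>I. card (S i)) \<le> a" "(\<Sum>i\<in>I. card (S i)) \<le> b"
      "(\<Sum>i\<in>I. card (V i - {v})) + (\<Sum>i\<in>I. card (S i))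
        \<le> a + b + (\<Sum>i\<in>I. card (vcomps (R i) (V i - {v} - S i)))"
    using ab finite_index finite_part by (subst (asm) mem_sum_inertia_set) auto
  define T where "T = insert v (\<Union>i\<in>I. S i)"
  have T: "T \<subseteq> total_verts" "v \<in> T"
    using S(1) centre_in_total by (auto simp: T_def total_verts_def)
  have T_part: "T \<inter> V i - {v} = S i" if "i \<in> I" for i
    using that S(1) part_unique unfolding T_def by blast
  have "card T = (\<Sum>i\<in>I. card (S i)) + 1"
    using card_minus_centre[OF T(1)] T_part T finite_total_verts
    by (metis (no_types, lifting) Suc_eq_plus1 card.remove finite_subset sum.cong)
  moreover have "(total_verts - T) \<inter> V i = V i - {v} - S i" if "i \<in> I" for i
    using T_part[OF that] T(2) that by (auto simp: total_verts_def)
  then have "card (vcomps total_rel (total_verts - T)) = (\<Sum>i\<in>I. card (vcomps (R i) (V i - {v} - S i)))"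
    using card_vcomps_without_centre[of "total_verts - T"] T(2) by simp
  moreover note card_total_minus_centre
  ultimately show ?thesis
    unfolding inertia_set_def using T S(2-) assms(2) rs by (auto intro!: exI[of _ T])
qed

theorem inertia_set_vertex_sum:
  "inertia_set total_rel total_verts =
    truncate_sum (card total_verts) (\<Sum>i\<in>I. inertia_set (R i) (V i)) \<union>
    truncate_sum (card total_verts) ((\<Sum>i\<in>I. inertia_set (R i) (V i - {v})) + {(1, 1)})"
    (is "?E = ?A \<union> ?B")
proof
  show "?E \<subseteq> ?A \<union> ?B"
  proof clarify
    fix r s assume "(r, s) \<in> ?E" "(r, s) \<notin> ?B"
    then obtain S where S: "S \<subseteq> total_verts" "card S \<le> r" "card S \<le> s" "r + s \<le> card total_verts"
        "card total_verts + card S \<le> r + s + card (vcomps total_rel (total_verts - S))"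
      by (auto simp: inertia_set_def)
    show "(r, s) \<in> ?A"
      using \<open>(r, s) \<notin> ?B\<close> S inertia_set_delete_centre[of S r s] inertia_set_keep_centre[of S r s]
      by (cases "v \<in> S") (auto simp: truncate_sum_def)
  qed
  show "?A \<union> ?B \<subseteq> ?E"
    using sum_inertia_set_subset sum_inertia_set_deleted_subset by (auto simp: truncate_sum_def)
qed

end

theorem theorem5p1:
  fixes G :: "'a pair_pre_digraph" and Gs :: "nat \<Rightarrow> 'a pair_pre_digraph"
    and v :: 'a and n k :: nat
  assumes "pair_graph G"
    and "card (pverts G) = n"
    and "3 \<le> n"
    and "cut_vertex (with_proj G) v"
    and "is_vertex_sum G v k Gs"
  shows "elementary_inertias (with_proj G) =
      truncate_sum n (\<Sum>i = 1..k. elementary_inertias (with_proj (Gs i))) \<union>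
      truncate_sum n
        ((\<Sum>i = 1..k. elementary_inertias (pre_digraph.del_vert (with_proj (Gs i)) v)) + {(1, 1)})"
proof -
  have k: "2 \<le> k"
    and Gs: "\<And>i. i \<in> {1..k} \<Longrightarrow> pair_graph (Gs i) \<and> v \<in> pverts (Gs i)"
    and meet: "\<And>i j. i \<in> {1..k} \<Longrightarrow> j \<in> {1..k} \<Longrightarrow> i \<noteq> j \<Longrightarrow> pverts (Gs i) \<inter> pverts (Gs j) = {v}"
    and union: "pverts G = (\<Union>i\<in>{1..k}. pverts (Gs i))" "parcs G = (\<Union>i\<in>{1..k}. parcs (Gs i))"
    using assms(5) unfolding is_vertex_sum_def by auto
  have graph: "fin_digraph (with_proj H)" "sym_digraph (with_proj H)" if "pair_graph H"
    for H :: "'a pair_pre_digraph"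
  proof -
    interpret pair_graph H by fact
    show "fin_digraph (with_proj H)" "sym_digraph (with_proj H)" by unfold_locales
  qed
  have whole: "elementary_inertias (with_proj H) = inertia_set (parcs H) (pverts H)"
    if "pair_graph H" for H :: "'a pair_pre_digraph"
    using elementary_inertias_eq_inertia_set[OF graph[OF that]] by simp
  have deleted: "elementary_inertias (pre_digraph.del_vert (with_proj H) v)
      = inertia_set (parcs H) (pverts H - {v})"
    if "pair_graph H" for H :: "'a pair_pre_digraph"
  proof -
    interpret pair_graph H by fact
    let ?D = "pre_digraph.del_vert (with_proj H) v"
    have ends: "arcs_ends ?D = {(x, y) \<in> parcs H. x \<noteq> v \<and> y \<noteq> v}"
      by (auto simp: arcs_ends_conv del_vert_simps)
    have fin: "fin_digraph ?D" by (rule fin_digraph_del_vert)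
    moreover have "symmetric ?D"
      unfolding symmetric_def ends using arcs_symmetric by (auto simp: sym_def)
    then have "sym_digraph ?D"
      using fin by (intro wf_digraph.sym_digraphI) (auto simp: fin_digraph_def)
    ultimately have "elementary_inertias ?D = inertia_set (arcs_ends ?D) (pverts H - {v})"
      by (simp add: elementary_inertias_eq_inertia_set del_vert_simps)
    also have "\<dots> = inertia_set (parcs H) (pverts H - {v})"
      unfolding ends by (rule inertia_set_cong) auto
    finally show ?thesis .
  qed
  interpret vertex_sum "{1..k}" "\<lambda>i. parcs (Gs i)" "\<lambda>i. pverts (Gs i)" v
  proof
    fix i assume i: "i \<in> {1..k}"
    interpret pair_graph "Gs i" using Gs[OF i] by blast
    show "finite (pverts (Gs i))" by (rule pair_finite_verts)
    show "sym (parcs (Gs i))" using arcs_symmetric by (auto simp: sym_def)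
    show "parcs (Gs i) \<subseteq> pverts (Gs i) \<times> pverts (Gs i)" using wellformed' by auto
  qed (use k Gs meet in auto)
  have "total_verts = pverts G" "total_rel = parcs G"
    unfolding total_verts_def total_rel_def union by simp_all
  then show ?thesis
    using inertia_set_vertex_sum assms(2) Gs whole deleted assms(1) by simp
qed

end
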